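(* If the wild numbers conjecture is true (i.e. the wild integer semigroup $\mathcal{W}(\mathbb{Z})$ consists of all positive integers not divisible by $3$, equivalently the wild numbers are exactly the primes other than $3$), then the weak $3x+1$ conjecture holds, i.e. the semigroup $\mathcal{W}^{-1}$ contains every positive integer.
   Context: For integers $n\ge 0$ let $g(n)=\frac{3n+2}{2n+1}$. The wild semigroup $\mathcal{W}$ is the multiplicative semigroup of positive rationals generated by $\{g(n): n\ge 0\}$ together with $\frac12$ (all finite products, repetitions allowed). The wild integer semigroup is $\mathcal{W}(\mathbb{Z})=\mathcal{W}\cap\mathbb{Z}$; the wild numbers are its irreducible elements (elements not expressible as a product of two nonunits of $\mathcal{W}(\mathbb{Z})$). $\mathcal{W}^{-1}=\{w^{-1}: w\in\mathcal{W}\}$ is the semigroup generated by $\{\frac{2n+1}{3n+2}: n\ge 0\}$ together with $2$. *)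

theory Defs
  imports Complex_Main "HOL-Computational_Algebra.Primes"
begin

inductive_set semigroup_generated :: "'a::semigroup_mult set \<Rightarrow> 'a set" for S where
  gen: "x \<in> S \<Longrightarrow> x \<in> semigroup_generated S"
| mult: "x \<in> semigroup_generated S \<Longrightarrow> y \<in> semigroup_generated S \<Longrightarrow> x * y \<in> semigroup_generated S"

definition wild_gen :: "nat \<Rightarrow> rat" where
  "wild_gen n = of_nat (3 * n + 2) / of_nat (2 * n + 1)"

definition wild_semigroup :: "rat set" where
  "wild_semigroup = semigroup_generated (range wild_gen \<union> {1 / 2})"

definition wild_integer_semigroup :: "rat set" where
  "wild_integer_semigroup = wild_semigroup \<inter> \<int>"

definition wild_unit :: "rat \<Rightarrow> bool" where
  "wild_unit u \<longleftrightarrow> u \<in> wild_integer_semigroup \<and> (\<exists>v\<in>wild_integer_semigroup. u * v = 1)"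

text \<open>As usual for irreducible elements, units are excluded
  (\<open>1 = 1/2 * wild_gen 0\<close> does belong to the wild integer semigroup).\<close>

definition wild_numbers :: "rat set" where
  "wild_numbers = {w \<in> wild_integer_semigroup. \<not> wild_unit w \<and>
     (\<forall>a\<in>wild_integer_semigroup. \<forall>b\<in>wild_integer_semigroup.
        w = a * b \<longrightarrow> wild_unit a \<or> wild_unit b)}"

definition inverse_wild_semigroup :: "rat set" where
  "inverse_wild_semigroup = inverse ` wild_semigroup"

definition wild_numbers_conjecture :: bool where
  "wild_numbers_conjecture \<longleftrightarrow>
     wild_integer_semigroup = {of_nat n |n. 0 < n \<and> \<not> 3 dvd n}"

definition weak_3x1_conjecture :: bool where
  "weak_3x1_conjecture \<longleftrightarrow> (\<forall>n::nat. 0 < n \<longrightarrow> of_nat n \<in> inverse_wild_semigroup)"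

lemma inverse_semigroup_generated:
  fixes S :: "'a::field set"
  shows "inverse ` semigroup_generated S = semigroup_generated (inverse ` S)"
proof
  have "inverse x \<in> semigroup_generated (inverse ` S)" if "x \<in> semigroup_generated S" for x
    using that by induction (auto intro: semigroup_generated.intros)
  then show "inverse ` semigroup_generated S \<subseteq> semigroup_generated (inverse ` S)" by blast
next
  have "inverse x \<in> semigroup_generated S" if "x \<in> semigroup_generated (inverse ` S)" for x
    using that by induction (auto intro: semigroup_generated.intros)
  then show "semigroup_generated (inverse ` S) \<subseteq> inverse ` semigroup_generated S"
    by (metis imageI inverse_inverse_eq subsetI)
qed

lemma inverse_wild_semigroup_eq:
  "inverse_wild_semigroup =
     semigroup_generated (range (\<lambda>n. of_nat (2 * n + 1) / of_nat (3 * n + 2)) \<union> {2})"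
  unfolding inverse_wild_semigroup_def wild_semigroup_def inverse_semigroup_generated
  by (simp add: image_Un image_image wild_gen_def)

end

theory Submission
  imports Defs "HOL-Number_Theory.Residues"
begin

text \<open>
  Let \<open>S\<close> be the set of positive integers in the inverse wild semigroup. An odd number lies in \<open>S\<close>
  as soon as its image \<open>2 * i + 1 \<mapsto> 3 * i + 2\<close> under the accelerated \<open>3x + 1\<close> map does, and the
  wild numbers conjecture makes \<open>S\<close> closed under division by numbers prime to 3.

  For an odd prime \<open>p \<equiv> 2\<close> modulo 3, Fermat's theorem gives \<open>2 ^ (p - 1) = 3 * (p * k) + 1\<close>, so that
  \<open>p * k\<close> is mapped to \<open>2 ^ (p - 2)\<close>. As \<open>p - 1\<close> is even and prime to 3, \<open>2 ^ (p - 1)\<close> is 4 or 7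
  modulo 9; thus \<open>k\<close> is prime to 3 and \<open>p \<in> S\<close>. An arbitrary odd prime \<open>p\<close> is mapped to a number less
  than \<open>2 * p\<close> and congruent to 2 modulo 3. That number is either a prime of the kind just treated
  or a product of primes less than \<open>p\<close>, so induction over the primes gives \<open>p \<in> S\<close>.
\<close>

lemma mult_closed_mem_if_prime_divisors_mem:
  fixes x :: "'a :: factorial_semiring"
  assumes unit: "\<And>u. is_unit u \<Longrightarrow> u \<in> S"
    and mult: "\<And>a b. a \<in> S \<Longrightarrow> b \<in> S \<Longrightarrow> a * b \<in> S"
    and "x \<noteq> 0" "\<And>p. prime p \<Longrightarrow> p dvd x \<Longrightarrow> p \<in> S"
  shows "x \<in> S"
  using assms(3,4)
proof (induction x rule: prime_divisors_induct)
  case (factor p x)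
  then show ?case
    by (auto intro: mult)
qed (auto intro: unit)

lemma prime_divisor_le_half:
  fixes n q :: nat
  assumes "prime q" "q dvd n" "\<not> prime n" "0 < n"
  shows "2 * q \<le> n"
proof -
  from \<open>q dvd n\<close> obtain c where "n = q * c" ..
  with assms have "c \<noteq> 1" "c \<noteq> 0"
    by auto
  then show ?thesis
    unfolding \<open>n = q * c\<close> by simp
qed

lemma prime_nat_iff_irreducible_not_dvd:
  fixes n q :: nat
  assumes "prime q"
  shows "prime n \<and> n \<noteq> q \<longleftrightarrow> \<not> q dvd n \<and> n \<noteq> 1 \<and>
    (\<forall>a b. \<not> q dvd a \<longrightarrow> \<not> q dvd b \<longrightarrow> n = a * b \<longrightarrow> a = 1 \<or> b = 1)" (is "_ \<longleftrightarrow> ?irreducible")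
proof
  assume n: "prime n \<and> n \<noteq> q"
  then have "\<not> q dvd n"
    using assms primes_dvd_imp_eq by blast
  with n show ?irreducible
    using prime_product by auto
next
  assume irr: ?irreducible
  then have not_dvd: "\<not> q dvd n" ..
  have "irreducible n"
  proof (rule irreducibleI)
    show "n \<noteq> 0"
      using not_dvd by (metis dvd_0_right)
    show "\<not> is_unit n"
      using irr by simp
  next
    fix a b assume "n = a * b"
    moreover from this have "\<not> q dvd a" "\<not> q dvd b"
      using not_dvd by auto
    ultimately show "is_unit a \<or> is_unit b"
      using irr by (auto simp del: One_nat_def)
  qed
  then have "prime n"
    by (simp only: irreducible_imp_prime_elem flip: prime_elem_nat_iff)
  moreover have "n \<noteq> q"
    using not_dvd by auto
  ultimately show "prime n \<and> n \<noteq> q" ..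
qed

lemma power_2_cong_mod_9: "[2 ^ n = 2 ^ (n mod 6)] (mod (9 :: nat))"
proof -
  have "[(2 ^ 6) ^ (n div 6) * 2 ^ (n mod 6) = 1 ^ (n div 6) * 2 ^ (n mod 6)] (mod (9 :: nat))"
    by (intro cong_scalar_right cong_pow) (simp add: cong_def)
  then show ?thesis
    by (simp only: power_one mult_1_left mult_div_mod_eq flip: power_mult power_add)
qed

lemma power_2_eq_3_mult_add_1E:
  assumes "even n" "\<not> 3 dvd n" "coprime 3 d" "[2 ^ n = 1] (mod d)"
  obtains k :: nat where "2 ^ n = 3 * (d * k) + 1" "\<not> 3 dvd k"
proof -
  have "n mod 6 = 2 \<or> n mod 6 = 4"
    using assms(1,2) by presburger
  then have "2 ^ n mod 9 = (4 :: nat) \<or> 2 ^ n mod 9 = (7 :: nat)"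
    using power_2_cong_mod_9[of n] by (auto simp: cong_def)
  then have "3 dvd (2 :: nat) ^ n - 1" and not_9: "\<not> 9 dvd (2 :: nat) ^ n - 1"
    by presburger+
  moreover have "d dvd 2 ^ n - 1"
    using assms(4) by (simp add: cong_altdef_nat)
  ultimately have "3 * d dvd 2 ^ n - 1"
    using \<open>coprime 3 d\<close> by (simp add: divides_mult)
  then obtain k where k: "2 ^ n - 1 = 3 * d * k" ..
  moreover have "(0 :: nat) < 2 ^ n"
    by simp
  ultimately have "2 ^ n = 3 * (d * k) + 1"
    by (simp only: mult.assoc)
  moreover have "\<not> 3 dvd k"
  proof
    assume "3 dvd k"
    then have "3 * 3 dvd 3 * d * k"
      by (simp add: mult.assoc)
    with not_9 k show False
      by simp
  qed
  ultimately show thesis ..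
qed

locale Collatz_semigroup =
  fixes S :: "nat set"
  assumes two_mem: "2 \<in> S"
    and mult_mem: "a \<in> S \<Longrightarrow> b \<in> S \<Longrightarrow> a * b \<in> S"
    and odd_preimage_mem: "3 * i + 2 \<in> S \<Longrightarrow> 2 * i + 1 \<in> S"
    and divide_mem: "a * k \<in> S \<Longrightarrow> \<not> 3 dvd k \<Longrightarrow> a \<in> S"
begin

lemma one_mem: "1 \<in> S"
  using odd_preimage_mem[of 0] two_mem by (simp add: numeral_2_eq_2)

lemma power_2_mem: "2 ^ n \<in> S"
  using one_mem by (induction n) (auto intro: mult_mem two_mem)

lemma mem_if_3_mult_add_1_eq_power_2:
  assumes "3 * m + 1 = 2 ^ Suc n"
  shows "m \<in> S"
proof -
  have pow: "3 * m + 1 = 2 * 2 ^ n"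
    using assms by simp
  then have "odd m"
    by presburger
  then obtain i where i: "m = 2 * i + 1"
    by (rule oddE)
  with pow have "3 * i + 2 = 2 ^ n"
    by simp
  then have "3 * i + 2 \<in> S"
    by (simp only: power_2_mem)
  then show ?thesis
    unfolding i by (rule odd_preimage_mem)
qed

lemma prime_2_mod_3_mem:
  assumes "prime p" "p mod 3 = 2"
  shows "p \<in> S"
proof (cases "p = 2")
  case True
  then show ?thesis
    by (simp add: two_mem)
next
  case False
  with \<open>prime p\<close> have "2 < p" "odd p"
    using prime_ge_2_nat[of p] prime_odd_nat[of p] by auto
  moreover from this have "[2 ^ (p - 1) = 1] (mod p)"
    using \<open>prime p\<close> by (intro fermat_theorem) (auto dest: dvd_imp_le)
  moreover have "coprime 3 p"
    using assms(2) by (intro prime_imp_coprime) auto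
  moreover have "even (p - 1)" "\<not> 3 dvd p - 1"
    using \<open>odd p\<close> \<open>p mod 3 = 2\<close> by presburger+
  ultimately obtain k where k: "2 ^ (p - 1) = 3 * (p * k) + 1" "\<not> 3 dvd k"
    using power_2_eq_3_mult_add_1E by metis
  have "p - 1 = Suc (p - 2)"
    using \<open>2 < p\<close> by simp
  with k(1) have "p * k \<in> S"
    by (intro mem_if_3_mult_add_1_eq_power_2[of _ "p - 2"]) simp
  then show "p \<in> S"
    using \<open>\<not> 3 dvd k\<close> by (rule divide_mem)
qed

lemma positive_mem_if_prime_divisors_mem:
  assumes "0 < n" "\<And>p. prime p \<Longrightarrow> p dvd n \<Longrightarrow> p \<in> S"
  shows "n \<in> S"
  using assms one_mem mult_mem by (intro mult_closed_mem_if_prime_divisors_mem[of S n]) auto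

lemma odd_image_mem_if_smaller_primes_mem:
  assumes "0 < i" and smaller: "\<And>q. prime q \<Longrightarrow> q < 2 * i + 1 \<Longrightarrow> q \<in> S"
  shows "3 * i + 2 \<in> S"
proof (cases "prime (3 * i + 2)")
  case True
  moreover have "(3 * i + 2) mod 3 = 2"
    by presburger
  ultimately show ?thesis
    by (rule prime_2_mod_3_mem)
next
  case False
  show ?thesis
  proof (rule positive_mem_if_prime_divisors_mem)
    fix q assume "prime q" "q dvd 3 * i + 2"
    with False have "2 * q \<le> 3 * i + 2"
      by (intro prime_divisor_le_half) simp_all
    with \<open>0 < i\<close> have "q < 2 * i + 1"
      by simp
    with \<open>prime q\<close> show "q \<in> S"
      by (rule smaller)
  qed simp
qed

lemma prime_mem: "prime p \<Longrightarrow> p \<in> S"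
proof (induction p rule: less_induct)
  case (less p)
  show ?case
  proof (cases "p = 2")
    case True
    then show ?thesis
      by (simp add: two_mem)
  next
    case False
    with \<open>prime p\<close> have "2 < p" "odd p"
      using prime_ge_2_nat[of p] prime_odd_nat[of p] by auto
    then obtain i where p: "p = 2 * i + 1" and "0 < i"
      by (auto elim!: oddE)
    have "3 * i + 2 \<in> S"
      using \<open>0 < i\<close> less.IH unfolding p by (intro odd_image_mem_if_smaller_primes_mem)
    then show ?thesis
      unfolding p by (rule odd_preimage_mem)
  qed
qed

lemma positive_mem: "0 < n \<Longrightarrow> n \<in> S"
  by (erule positive_mem_if_prime_divisors_mem) (rule prime_mem)

end

definition fractions_coprime_to :: "nat \<Rightarrow> 'a :: field_char_0 set" where
  "fractions_coprime_to m = {of_nat a / of_nat b |a b. coprime m a \<and> 0 < b}"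

lemma fractions_coprime_to_mult:
  assumes "x \<in> fractions_coprime_to m" "y \<in> fractions_coprime_to m"
  shows "x * y \<in> fractions_coprime_to m"
proof -
  from assms obtain a b c d where "x = of_nat a / of_nat b" "y = of_nat c / of_nat d"
      "coprime m a" "coprime m c" "0 < b" "0 < d"
    by (auto simp: fractions_coprime_to_def)
  then have "x * y = of_nat (a * c) / of_nat (b * d)" "coprime m (a * c)" "0 < b * d"
    by auto
  then show ?thesis
    unfolding fractions_coprime_to_def by blast
qed

lemma integer_fraction_coprime_toE:
  fixes x :: "'a :: field_char_0"
  assumes "x \<in> fractions_coprime_to m" "x \<in> \<int>"
  obtains n where "x = of_nat n" "coprime m n"
proof -
  from assms(1) obtain a b where ab: "x = of_nat a / of_nat b" "coprime m a" "0 < b"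
    by (auto simp: fractions_coprime_to_def)
  from \<open>x \<in> \<int>\<close> obtain z where z: "x = of_int z"
    by (rule Ints_cases)
  with ab have "of_int (z * int b) = (of_int (int a) :: 'a)"
    by (simp add: field_simps)
  then have a: "z * int b = int a"
    by (simp only: of_int_eq_iff)
  with \<open>0 < b\<close> have "0 \<le> z"
    by (metis of_nat_0_le_iff of_nat_0_less_iff zero_le_mult_iff not_less)
  then obtain n where n: "z = int n"
    by (rule nonneg_int_cases)
  with a have "n * b = a"
    by (simp flip: of_nat_mult)
  with ab(2) have "coprime m n"
    by auto
  with z n show thesis
    by (intro that[of n]) simp_all
qed

definition wild_naturals :: "nat set" where
  "wild_naturals = {n. of_nat n \<in> wild_semigroup}"

lemma wild_semigroup_mult:
  "x \<in> wild_semigroup \<Longrightarrow> y \<in> wild_semigroup \<Longrightarrow> x * y \<in> wild_semigroup"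
  unfolding wild_semigroup_def by (rule semigroup_generated.mult)

lemma one_in_wild_naturals: "1 \<in> wild_naturals"
proof -
  have "wild_gen 0 * (1 / 2) \<in> wild_semigroup"
    unfolding wild_semigroup_def
    by (intro semigroup_generated.mult semigroup_generated.gen) auto
  then show ?thesis
    by (simp add: wild_naturals_def wild_gen_def)
qed

lemma wild_naturals_mult: "a \<in> wild_naturals \<Longrightarrow> b \<in> wild_naturals \<Longrightarrow> a * b \<in> wild_naturals"
  by (simp add: wild_naturals_def wild_semigroup_mult)

lemma wild_semigroup_subset: "wild_semigroup \<subseteq> fractions_coprime_to 3"
proof
  fix x assume "x \<in> wild_semigroup"
  then show "x \<in> fractions_coprime_to 3"
    unfolding wild_semigroup_def
  proof induction
    case (gen x)
    have "coprime 3 (3 * n + 2)" for n :: nat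
      by (rule prime_imp_coprime) (simp, presburger)
    then have "wild_gen n \<in> fractions_coprime_to 3" for n
      unfolding fractions_coprime_to_def wild_gen_def by fastforce
    moreover have "1 / 2 \<in> fractions_coprime_to 3"
      unfolding fractions_coprime_to_def by (intro CollectI exI[of _ 1] exI[of _ 2]) simp
    ultimately show ?case
      using gen by blast
  qed (rule fractions_coprime_to_mult)
qed

lemma wild_integer_semigroup_eq: "wild_integer_semigroup = of_nat ` wild_naturals"
  using wild_semigroup_subset
  by (auto simp: wild_integer_semigroup_def wild_naturals_def elim!: integer_fraction_coprime_toE)

lemma not_3_dvd_wild_natural:
  assumes "n \<in> wild_naturals"
  shows "\<not> 3 dvd n"
proof -
  have "(of_nat n :: rat) \<in> fractions_coprime_to 3"
    using assms wild_semigroup_subset by (auto simp: wild_naturals_def)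
  then have "coprime 3 n"
    by (auto elim: integer_fraction_coprime_toE)
  then show ?thesis
    using coprime_absorb_left[of 3 n] by auto
qed

lemma wild_numbers_conjecture_iff: "wild_numbers_conjecture \<longleftrightarrow> wild_naturals = {n. \<not> 3 dvd n}"
proof -
  have "{of_nat n |n. 0 < n \<and> \<not> 3 dvd n} = (of_nat ` {n. \<not> 3 dvd n} :: rat set)"
    by (auto intro!: gr0I)
  then show ?thesis
    unfolding wild_numbers_conjecture_def wild_integer_semigroup_eq
    by (simp add: inj_image_eq_iff inj_of_nat)
qed

lemma wild_unit_of_nat_iff: "wild_unit (of_nat n) \<longleftrightarrow> n = 1"
proof
  assume "wild_unit (of_nat n)"
  then obtain m where "of_nat (n * m) = (of_nat 1 :: rat)"
    by (auto simp: wild_unit_def wild_integer_semigroup_eq)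
  then show "n = 1"
    by (simp only: of_nat_eq_iff nat_mult_eq_1_iff)
next
  assume "n = 1"
  then show "wild_unit (of_nat n)"
    using one_in_wild_naturals by (force simp: wild_unit_def wild_integer_semigroup_eq)
qed

lemma wild_numbers_eq:
  "wild_numbers = of_nat ` {n \<in> wild_naturals. n \<noteq> 1 \<and>
     (\<forall>a\<in>wild_naturals. \<forall>b\<in>wild_naturals. n = a * b \<longrightarrow> a = 1 \<or> b = 1)}"
  unfolding wild_numbers_def wild_integer_semigroup_eq
  by (simp only: Compr_image_eq ball_simps wild_unit_of_nat_iff of_nat_eq_iff flip: of_nat_mult)

lemma wild_numbers_if_conjecture:
  assumes wild_numbers_conjecture
  shows "wild_numbers = {of_nat p |p. prime p \<and> p \<noteq> 3}"
proof -
  have wild_naturals: "wild_naturals = {n. \<not> 3 dvd n}"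
    using assms by (simp only: wild_numbers_conjecture_iff)
  have "wild_numbers = of_nat ` {p. prime p \<and> p \<noteq> 3}"
    unfolding wild_numbers_eq wild_naturals by (simp add: prime_nat_iff_irreducible_not_dvd[of 3])
  then show ?thesis
    by auto
qed

lemma conjecture_if_wild_numbers:
  assumes "wild_numbers = {of_nat p |p. prime p \<and> p \<noteq> 3}"
  shows wild_numbers_conjecture
proof -
  have prime_mem: "p \<in> wild_naturals" if "prime p" "p \<noteq> 3" for p
  proof -
    have "of_nat p \<in> wild_numbers"
      using assms that by blast
    then show ?thesis
      by (auto simp: wild_numbers_eq)
  qed
  have "n \<in> wild_naturals" if "\<not> 3 dvd n" for n
  proof (rule mult_closed_mem_if_prime_divisors_mem)
    show "n \<noteq> 0"
      using that by (metis dvd_0_right)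
    show "p \<in> wild_naturals" if "prime p" "p dvd n" for p
      using prime_mem that \<open>\<not> 3 dvd n\<close> by blast
  qed (use one_in_wild_naturals in \<open>auto intro: wild_naturals_mult\<close>)
  then show ?thesis
    unfolding wild_numbers_conjecture_iff using not_3_dvd_wild_natural by blast
qed

lemma inverse_wild_semigroup_mult:
  "x \<in> inverse_wild_semigroup \<Longrightarrow> y \<in> inverse_wild_semigroup \<Longrightarrow> x * y \<in> inverse_wild_semigroup"
  unfolding inverse_wild_semigroup_eq by (rule semigroup_generated.mult)

lemma Collatz_semigroup_if_conjecture:
  assumes wild_numbers_conjecture
  shows "Collatz_semigroup {n. of_nat n \<in> inverse_wild_semigroup}"
proof (unfold_locales, unfold mem_Collect_eq)
  show "of_nat 2 \<in> inverse_wild_semigroup"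
    unfolding inverse_wild_semigroup_eq by (rule semigroup_generated.gen) simp
next
  fix a b assume "of_nat a \<in> inverse_wild_semigroup" "of_nat b \<in> inverse_wild_semigroup"
  then show "of_nat (a * b) \<in> inverse_wild_semigroup"
    by (simp add: inverse_wild_semigroup_mult)
next
  fix i assume image: "of_nat (3 * i + 2) \<in> inverse_wild_semigroup"
  have "of_nat (2 * i + 1) / of_nat (3 * i + 2) \<in> inverse_wild_semigroup"
    unfolding inverse_wild_semigroup_eq by (rule semigroup_generated.gen) simp
  from inverse_wild_semigroup_mult[OF this image]
  show "of_nat (2 * i + 1) \<in> inverse_wild_semigroup"
    by (simp del: of_nat_add of_nat_mult)
next
  fix a k :: nat assume prod: "of_nat (a * k) \<in> inverse_wild_semigroup" and "\<not> 3 dvd k"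
  then have "of_nat k \<in> wild_semigroup"
    using assms by (auto simp: wild_numbers_conjecture_iff wild_naturals_def)
  then have "inverse (of_nat k) \<in> inverse_wild_semigroup"
    unfolding inverse_wild_semigroup_def by (rule imageI)
  moreover have "k \<noteq> 0"
    using \<open>\<not> 3 dvd k\<close> by (metis dvd_0_right)
  ultimately show "of_nat a \<in> inverse_wild_semigroup"
    using inverse_wild_semigroup_mult[OF prod] by (force simp: field_simps)
qed

theorem theorem3p4:
  "(wild_numbers_conjecture \<longleftrightarrow> wild_numbers = {of_nat p |p. prime p \<and> p \<noteq> 3}) \<and>
   (wild_numbers_conjecture \<longrightarrow> weak_3x1_conjecture)"
proof (intro conjI iffI impI)
  assume wild_numbers_conjecture
  then show "wild_numbers = {of_nat p |p. prime p \<and> p \<noteq> 3}"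
    by (rule wild_numbers_if_conjecture)
next
  assume "wild_numbers = {of_nat p |p. prime p \<and> p \<noteq> 3}"
  then show wild_numbers_conjecture
    by (rule conjecture_if_wild_numbers)
next
  assume wild_numbers_conjecture
  then interpret Collatz_semigroup "{n. of_nat n \<in> inverse_wild_semigroup}"
    by (rule Collatz_semigroup_if_conjecture)
  show weak_3x1_conjecture
    using positive_mem by (simp add: weak_3x1_conjecture_def)
qed

end
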